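(* Let $a$ and $x$ be indeterminates. For all positive integers $n$, $$\det_{0\le i,j\le n-1}\left(a^i\binom {x+i+j-1}j+\binom {x-i+j-1}j\right)=2(a-1)^{\binom n2}.$$
   Context: The binomial coefficient is $\binom{\alpha}{p}=\frac{\alpha(\alpha-1)\cdots(\alpha-p+1)}{p!}$ if $p\ge 0$ is an integer, and $0$ if $p<0$. *)

theory Defs
  imports
    "HOL-Computational_Algebra.Polynomial_Factorial"
    "Jordan_Normal_Form.Determinant"
begin

text \<open>
  The indeterminates \<open>a\<close> and \<open>x\<close> are the two variables of \<open>K[x][a]\<close> (\<open>x\<close> the inner one,
  \<open>a\<close> the outer one), for an arbitrary field \<open>K\<close> of characteristic \<open>0\<close>. They are regarded as
  elements of the fraction field \<open>K(x, a)\<close>, so that the division by \<open>p!\<close> in the library's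
  \<open>\<alpha> gchoose p\<close> is the division of a field.
\<close>

instance fract :: ("{idom, ring_char_0}") field_char_0
proof
  show "inj (of_nat :: nat \<Rightarrow> 'a fract)"
    by (rule injI) (simp add: of_nat_fract eq_fract)
qed

definition indet_a :: "'k::field_char_0 poly poly fract" where
  "indet_a = to_fract [:0, 1:]"

definition indet_x :: "'k::field_char_0 poly poly fract" where
  "indet_x = to_fract [:[:0, 1:]:]"

end

theory Submission
  imports Defs "HOL-Computational_Algebra.Polynomial_FPS"
begin

text \<open>
  Since \<open>(y + j - 1) gchoose j\<close> is the \<open>j\<close>-th coefficient of \<open>(1 - X) powr (-y)\<close>, the matrix has
  entries \<open>[X^j] (F * (u^i + v^i))\<close> with \<open>F = (1 - X) powr (-x)\<close>, \<open>u = a / (1 - X)\<close> and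
  \<open>v = 1 - X\<close>. As \<open>u * v = a\<close> is constant, \<open>u^i + v^i\<close> is a polynomial of degree \<open>i\<close> in
  \<open>u + v\<close>, or equally in \<open>t = u + v - (1 + a) = (a - 1) X + O(X^2)\<close>; it is monic for \<open>i > 0\<close>
  and equals \<open>2\<close> for \<open>i = 0\<close>. Hence the matrix is a product of a lower triangular matrix with
  diagonal \<open>2, 1, \<dots>, 1\<close> and the upper triangular matrix \<open>[X^j] (F * t^k)\<close> with diagonal
  \<open>(a - 1)^k\<close>.
\<close>

definition fps_neg_binomial :: "'a::field_char_0 \<Rightarrow> 'a fps" where
  "fps_neg_binomial y = Abs_fps (\<lambda>j. (y + of_nat j - 1) gchoose j)"

lemma fps_neg_binomial_nth: "fps_nth (fps_neg_binomial y) j = (- 1) ^ j * ((- y) gchoose j)"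
  by (simp add: fps_neg_binomial_def gbinomial_minus)

text \<open>Vandermonde's convolution: exponents add when powers of \<open>1 - X\<close> are
  multiplied, and the sign \<open>(- 1) ^ n\<close> splits between the two factors.\<close>

lemma fps_neg_binomial_add:
  "fps_neg_binomial (y + z) = fps_neg_binomial y * fps_neg_binomial z"
proof (rule fps_ext)
  fix n
  have "(- (y + z)) gchoose n = (\<Sum>i=0..n. ((- y) gchoose i) * ((- z) gchoose (n - i)))"
    using arg_cong[OF fps_binomial_add_mult[of "- y" "- z"], of "\<lambda>f. fps_nth f n"]
    by (simp add: fps_mult_nth)
  then have "fps_nth (fps_neg_binomial (y + z)) n
      = (\<Sum>i=0..n. (- 1) ^ n * (((- y) gchoose i) * ((- z) gchoose (n - i))))"
    by (simp add: fps_neg_binomial_nth sum_distrib_left)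
  also have "\<dots> = (\<Sum>i=0..n. fps_nth (fps_neg_binomial y) i * fps_nth (fps_neg_binomial z) (n - i))"
  proof (rule sum.cong, simp)
    fix i assume "i \<in> {0..n}"
    then have "(- 1 :: 'a) ^ n = (- 1) ^ i * (- 1) ^ (n - i)"
      by (simp flip: power_add)
    then show "(- 1) ^ n * (((- y) gchoose i) * ((- z) gchoose (n - i)))
        = fps_nth (fps_neg_binomial y) i * fps_nth (fps_neg_binomial z) (n - i)"
      by (simp add: fps_neg_binomial_nth)
  qed
  finally show "fps_nth (fps_neg_binomial (y + z)) n = fps_nth (fps_neg_binomial y * fps_neg_binomial z) n"
    by (simp add: fps_mult_nth)
qed

lemma fps_neg_binomial_0: "fps_neg_binomial 0 = 1"
  by (rule fps_ext) (simp add: fps_neg_binomial_nth gbinomial_0_left)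

lemma fps_neg_binomial_of_nat_mult: "fps_neg_binomial (of_nat i * y) = fps_neg_binomial y ^ i"
  by (induction i) (simp_all add: fps_neg_binomial_0 fps_neg_binomial_add distrib_right)

lemma fps_neg_binomial_1_nth: "fps_nth (fps_neg_binomial 1) j = 1"
  by (simp add: fps_neg_binomial_def flip: binomial_gbinomial)

lemma fps_neg_binomial_minus_1: "fps_neg_binomial (- 1) = 1 - fps_X"
proof (rule fps_ext)
  fix j
  show "fps_nth (fps_neg_binomial (- 1)) j = fps_nth (1 - fps_X :: 'a fps) j"
    using binomial_gbinomial[of 1 j, where 'a = 'a]
    by (cases "j > 1") (auto simp: fps_neg_binomial_nth fps_X_def binomial_eq_0 not_less le_Suc_eq)
qed

text \<open>Dickson polynomials of the first kind, in the shifted variable \<open>X + c\<close>.\<close>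

fun dickson :: "'a::idom \<Rightarrow> 'a \<Rightarrow> nat \<Rightarrow> 'a poly" where
  "dickson a c 0 = [:2:]"
| "dickson a c (Suc 0) = [:c, 1:]"
| "dickson a c (Suc (Suc n)) = [:c, 1:] * dickson a c (Suc n) - smult a (dickson a c n)"

lemma degree_dickson_le: "degree (dickson a c n) \<le> n"
proof (induction a c n rule: dickson.induct)
  case (3 a c n)
  have "degree ([:c, 1:] * dickson a c (Suc n)) \<le> Suc (Suc n)"
    using degree_mult_le[of "[:c, 1:]" "dickson a c (Suc n)"] 3(1) by simp
  moreover have "degree (smult a (dickson a c n)) \<le> Suc (Suc n)"
    using degree_smult_le[of a "dickson a c n"] 3(2) by linarith
  ultimately show ?case
    by (simp only: dickson.simps degree_diff_le)
qed simp_all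

text \<open>In the recursion only the product with \<open>[:c, 1:]\<close> reaches the top degree,
  and it starts from the monic case \<open>Suc 0\<close>, so the exceptional 2 at index 0 does not
  propagate.\<close>

lemma coeff_dickson_self: "coeff (dickson a c n) n = (if n = 0 then 2 else 1)"
proof (induction a c n rule: dickson.induct)
  case (3 a c n)
  have "coeff (dickson a c (Suc n)) (Suc (Suc n)) = 0" "coeff (dickson a c n) (Suc (Suc n)) = 0"
    using degree_dickson_le[of a c "Suc n"] degree_dickson_le[of a c n]
    by (auto intro!: coeff_eq_0)
  with 3 show ?case by simp
qed simp_all

text \<open>The power sums \<open>p n = u ^ n + v ^ n\<close> obey
  \<open>p (n + 2) = (u + v) * p (n + 1) - u * v * p n\<close>, which is the recursion of
  \<open>dickson\<close> once \<open>X + c\<close> becomes \<open>u + v\<close>. Composition with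
  \<open>t\<close> respects products because \<open>t\<close> has no constant term.\<close>

lemma power_sum_eq_dickson:
  fixes u v :: "'a::idom fps"
  assumes uv: "u * v = fps_const a" and t: "t = u + v - fps_const c" "fps_nth t 0 = 0"
  shows "u ^ n + v ^ n = fps_of_poly (dickson a c n) oo t"
  using uv t
proof (induction a c n rule: dickson.induct)
  case (1 a c)
  then show ?case by (simp add: fps_of_poly_const fps_const_compose flip: numeral_fps_const)
next
  case (2 a c)
  have "fps_of_poly [:c, 1:] oo t = t + fps_const c"
    using 2(3) by (simp add: fps_of_poly_pCons fps_compose_add_distrib fps_const_compose)
  with 2(2) show ?case by simp
next
  case (3 a c n)
  have "fps_of_poly (dickson a c (Suc (Suc n))) oo t
      = (t + fps_const c) * (fps_of_poly (dickson a c (Suc n)) oo t)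
        - fps_const a * (fps_of_poly (dickson a c n) oo t)"
    using 3(5)
    by (simp add: fps_of_poly_diff fps_of_poly_mult fps_of_poly_smult fps_of_poly_pCons
        fps_compose_sub_distrib fps_compose_mult_distrib fps_compose_add_distrib fps_const_compose
        del: mult_pCons_left)
  also have "\<dots> = (u + v) * (u ^ Suc n + v ^ Suc n) - (u * v) * (u ^ n + v ^ n)"
    using 3 by simp
  also have "\<dots> = u ^ Suc (Suc n) + v ^ Suc (Suc n)"
    by (simp add: algebra_simps)
  finally show ?case by simp
qed

text \<open>The sum runs up to a common bound \<open>n\<close> instead of the degree of
  \<open>p\<close>, so that all rows of the matrix expand in the same powers of
  \<open>t\<close>.\<close>

lemma fps_of_poly_compose_eq_sum:
  fixes t :: "'a::idom fps"
  assumes t: "fps_nth t 0 = 0" and deg: "degree p < n"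
  shows "fps_of_poly p oo t = (\<Sum>k<n. fps_const (coeff p k) * t ^ k)"
proof -
  obtain m where n: "n = Suc m" using deg by (cases n) auto
  have "p = (\<Sum>k<n. monom (coeff p k) k)"
    using deg by (simp add: n lessThan_Suc_atMost poly_as_sum_of_monoms')
  then have "fps_of_poly p oo t = fps_of_poly (\<Sum>k<n. monom (coeff p k) k) oo t"
    by simp
  also have "\<dots> = (\<Sum>k<n. fps_const (coeff p k) * t ^ k)"
    using t by (simp add: fps_of_poly_sum fps_of_poly_monom fps_compose_sum_distrib
        fps_compose_mult_distrib fps_const_compose flip: fps_compose_power)
  finally show ?thesis .
qed

lemma fps_nth_mult_power_eq_0:
  assumes "fps_nth t 0 = 0" "j < k"
  shows "fps_nth (f * t ^ k) j = 0"
  using startsby_zero_power_prefix[OF assms(1), of k] assms(2)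
  by (auto simp: fps_mult_nth intro!: sum.neutral)

text \<open>As \<open>t ^ k\<close> begins at order \<open>k\<close>, only the constant term of
  \<open>f\<close> survives in the convolution.\<close>

lemma fps_nth_mult_power_self:
  assumes "fps_nth t 0 = 0"
  shows "fps_nth (f * t ^ k) k = fps_nth f 0 * fps_nth t 1 ^ k"
proof -
  have "fps_nth (f * t ^ k) k = (\<Sum>i=0..k. fps_nth f i * fps_nth (t ^ k) (k - i))"
    by (rule fps_mult_nth)
  also have "\<dots> = (\<Sum>i\<in>{0}. fps_nth f i * fps_nth (t ^ k) (k - i))"
    using startsby_zero_power_prefix[OF assms, of k]
    by (intro sum.mono_neutral_right) auto
  finally show ?thesis
    by (simp add: startsby_zero_power_nth_same[OF assms])
qed

lemma det_power_sum_coeffs: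
  fixes f u v :: "'a::idom fps"
  assumes uv: "u * v = fps_const a" and t0: "fps_nth (u + v) 0 = c" and n: "n > 0"
  shows "det (mat n n (\<lambda>(i, j). fps_nth (f * (u ^ i + v ^ i)) j))
    = 2 * fps_nth f 0 ^ n * fps_nth (u + v) 1 ^ (n choose 2)"
proof -
  \<comment> \<open>Removing the constant term makes \<open>t\<close> divisible by \<open>X\<close>;
    this permits composition with \<open>t\<close> and makes \<open>B\<close> triangular.\<close>
  define t where "t = u + v - fps_const c"
  have t_0: "fps_nth t 0 = 0" and t_1: "fps_nth t 1 = fps_nth (u + v) 1"
    using t0 by (simp_all add: t_def)
  define C where "C = mat n n (\<lambda>(i, k). coeff (dickson a c i) k)"
  define B where "B = mat n n (\<lambda>(k, j). fps_nth (f * t ^ k) j)"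
  have carrier: "C \<in> carrier_mat n n" "B \<in> carrier_mat n n"
    by (simp_all add: C_def B_def)
  have "mat n n (\<lambda>(i, j). fps_nth (f * (u ^ i + v ^ i)) j) = C * B"
  proof (rule eq_matI)
    fix i j assume "i < dim_row (C * B)" "j < dim_col (C * B)"
    then have ij: "i < n" "j < n" by (simp_all add: C_def B_def)
    have "f * (u ^ i + v ^ i) = f * (\<Sum>k<n. fps_const (coeff (dickson a c i) k) * t ^ k)"
      using power_sum_eq_dickson[OF uv t_def t_0] degree_dickson_le[of a c i] ij
      by (simp add: fps_of_poly_compose_eq_sum[OF t_0])
    also have "\<dots> = (\<Sum>k<n. fps_const (coeff (dickson a c i) k) * (f * t ^ k))"
      by (simp add: sum_distrib_left mult.left_commute)
    finally have "fps_nth (f * (u ^ i + v ^ i)) j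
        = (\<Sum>k<n. coeff (dickson a c i) k * fps_nth (f * t ^ k) j)"
      by (simp add: fps_sum_nth)
    then show "mat n n (\<lambda>(i, j). fps_nth (f * (u ^ i + v ^ i)) j) $$ (i, j) = (C * B) $$ (i, j)"
      using ij by (simp add: C_def B_def scalar_prod_def atLeast0LessThan)
  qed (simp_all add: C_def B_def)
  moreover have "det C = 2"
  proof -
    have "det C = prod_list (diag_mat C)"
      using degree_dickson_le
      by (intro det_lower_triangular[OF _ carrier(1)])
        (auto simp: C_def intro!: coeff_eq_0 intro: le_less_trans)
    \<comment> \<open>The factor 2 comes from row 0 alone, which is present because
      \<open>n > 0\<close>.\<close>
    also have "\<dots> = (\<Prod>i<n. if i = 0 then 2 else 1)"
      by (simp add: prod_list_diag_prod C_def coeff_dickson_self atLeast0LessThan)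
    finally show ?thesis using n by simp
  qed
  moreover have "det B = fps_nth f 0 ^ n * fps_nth (u + v) 1 ^ (n choose 2)"
  proof -
    have "det B = prod_list (diag_mat B)"
      by (rule det_upper_triangular[OF _ carrier(2)])
        (auto simp: B_def upper_triangular_def fps_nth_mult_power_eq_0[OF t_0])
    also have "\<dots> = (\<Prod>k<n. fps_nth f 0 * fps_nth (u + v) 1 ^ k)"
      by (simp add: prod_list_diag_prod B_def fps_nth_mult_power_self[OF t_0] t_1[simplified]
          atLeast0LessThan)
    also have "\<dots> = fps_nth f 0 ^ n * fps_nth (u + v) 1 ^ (\<Sum>k<n. k)"
      by (simp add: prod.distrib power_sum del: fps_add_nth)
    also have "(\<Sum>k<n. k) = n choose 2"
      using Sum_Ico_nat[of 0 n] by (simp add: choose_two atLeast0LessThan)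
    finally show ?thesis .
  qed
  ultimately show ?thesis
    by (simp add: det_mult[OF carrier])
qed

lemma det_gchoose_power_sum:
  fixes a x :: "'a::field_char_0"
  assumes "n > 0"
  shows "det (mat n n (\<lambda>(i, j).
             a ^ i * ((x + of_nat i + of_nat j - 1) gchoose j)
               + ((x - of_nat i + of_nat j - 1) gchoose j)))
         = 2 * (a - 1) ^ (n choose 2)"
proof -
  define f where "f = fps_neg_binomial x"
  define u where "u = fps_const a * fps_neg_binomial 1"
  define v where "v = fps_neg_binomial (- 1 :: 'a)"
  have "u * v = fps_const a"
    by (simp add: u_def v_def mult.assoc fps_neg_binomial_0 flip: fps_neg_binomial_add)
  \<comment> \<open>Here \<open>u + v\<close> is \<open>a / (1 - X) + (1 - X)\<close>, whose linear
    coefficient is \<open>a - 1\<close>.\<close>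
  moreover have "fps_nth f 0 = 1" "fps_nth (u + v) 1 = a - 1"
    by (simp_all add: f_def fps_neg_binomial_nth u_def v_def fps_neg_binomial_1_nth
        fps_neg_binomial_minus_1)
  moreover have "a ^ i * ((x + of_nat i + of_nat j - 1) gchoose j)
      + ((x - of_nat i + of_nat j - 1) gchoose j) = fps_nth (f * (u ^ i + v ^ i)) j" for i j
  proof -
    \<comment> \<open>Multiplying \<open>f\<close> by \<open>u ^ i\<close> shifts \<open>x\<close>
      up by \<open>i\<close> and brings in \<open>a ^ i\<close>; multiplying by \<open>v ^ i\<close>
      shifts \<open>x\<close> down by \<open>i\<close>.\<close>
    have "f * (u ^ i + v ^ i) = fps_const (a ^ i) * fps_neg_binomial (x + of_nat i)
        + fps_neg_binomial (x - of_nat i)"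
      using fps_neg_binomial_of_nat_mult[of i "1 :: 'a"] fps_neg_binomial_of_nat_mult[of i "- 1 :: 'a"]
        fps_neg_binomial_add[of x "of_nat i"] fps_neg_binomial_add[of x "- of_nat i"]
      by (simp add: f_def u_def v_def algebra_simps)
    then show ?thesis by (simp add: fps_neg_binomial_def)
  qed
  ultimately show ?thesis
    using det_power_sum_coeffs[OF _ refl assms, of u v a f] by simp
qed

theorem theorem3:
  fixes n :: nat and a x :: "'k::field_char_0 poly poly fract"
  assumes "a = indet_a" and "x = indet_x" and "n > 0"
  shows "det (mat n n (\<lambda>(i, j).
             a ^ i * ((x + of_nat i + of_nat j - 1) gchoose j)
               + ((x - of_nat i + of_nat j - 1) gchoose j)))
         = 2 * (a - 1) ^ (n choose 2)"
  using assms(3) by (rule det_gchoose_power_sum)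

end
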